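(* For every integer $n\ge 3$, \[ \frac{2}{9}(n-3)^2 \le H_{\mathrm{s}}(n,3) \le \frac14 n^2. \]
   Context: A pure simplicial complex of dimension $d-1$ on $[n]=\{1,\dots,n\}$ is a nonempty family $C$ of $d$-element subsets of $[n]$ (facets). Its adjacency graph has the facets as vertices, with $X,Y$ adjacent when $|X\setminus Y|=1$. $C$ is strongly connected if this graph is connected, and its diameter is the diameter of this graph. $H_{\mathrm{s}}(n,d)$ denotes the maximum diameter of strongly connected pure $(d-1)$-dimensional complexes on $[n]$; so $H_{\mathrm{s}}(n,3)$ concerns families of $3$-subsets of $[n]$. *)

theory Defs
  imports "Graph_Theory.Graph_Theory"
begin

text \<open>A pure simplicial complex is represented by its set of facets; it has dimension \<open>d - 1\<close>
  and need not use all the vertices in \<open>{1..n}\<close>.\<close>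

definition pure_complex :: "nat \<Rightarrow> nat \<Rightarrow> nat set set \<Rightarrow> bool" where
  "pure_complex n d C \<longleftrightarrow> C \<noteq> {} \<and> (\<forall>X\<in>C. X \<subseteq> {1..n} \<and> card X = d)"

text \<open>An undirected graph is rendered as a digraph with an arc in each direction. The arc set below
  is symmetric whenever all members of \<open>C\<close> are finite and of the same size.\<close>

definition adjacency_graph :: "nat set set \<Rightarrow> nat set pair_pre_digraph" where
  "adjacency_graph C = \<lparr>pverts = C, parcs = {(X, Y). X \<in> C \<and> Y \<in> C \<and> card (X - Y) = 1}\<rparr>"

lemma pair_wf_digraph_adjacency_graph: "pair_wf_digraph (adjacency_graph C)"
  by unfold_locales (auto simp: adjacency_graph_def)

lemma wf_digraph_adjacency_graph: "wf_digraph (with_proj (adjacency_graph C))"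
  by (simp add: wf_digraph_wp_iff pair_wf_digraph_adjacency_graph)

definition strongly_connected_complex :: "nat set set \<Rightarrow> bool" where
  "strongly_connected_complex C \<longleftrightarrow> Digraph_Component.connected (with_proj (adjacency_graph C))"

text \<open>With unit arc weights, \<open>\<mu>\<close> is the number of arcs of a shortest walk.\<close>

definition graph_diameter :: "('a, 'b) pre_digraph \<Rightarrow> ereal" where
  "graph_diameter G = (SUP u\<in>verts G. SUP v\<in>verts G. wf_digraph.\<mu> G (\<lambda>_. 1) u v)"

definition complex_diameter :: "nat set set \<Rightarrow> ereal" where
  "complex_diameter C = graph_diameter (with_proj (adjacency_graph C))"

definition H_s :: "nat \<Rightarrow> nat \<Rightarrow> ereal" where
  "H_s n d = Max {complex_diameter C | C. pure_complex n d C \<and> strongly_connected_complex C}"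

text \<open>The maximum is over a finite set, nonempty as soon as \<open>d \<le> n\<close>.\<close>

lemma finite_diameters:
  "finite {complex_diameter C | C. pure_complex n d C \<and> strongly_connected_complex C}"
proof -
  have "{C. pure_complex n d C \<and> strongly_connected_complex C} \<subseteq> Pow (Pow {1..n})"
    by (auto simp: pure_complex_def)
  then have "finite {C. pure_complex n d C \<and> strongly_connected_complex C}"
    by (rule finite_subset) simp
  then show ?thesis by simp
qed

lemma diameters_nonempty:
  assumes "d \<le> n"
  shows "{complex_diameter C | C. pure_complex n d C \<and> strongly_connected_complex C} \<noteq> {}"
proof -
  have "pure_complex n d {{1..d}}"
    using assms by (auto simp: pure_complex_def)
  moreover have "strongly_connected_complex {{1..d}}"
    unfolding strongly_connected_complex_def Digraph_Component.connected_def
    by (auto simp: strongly_connected_def adjacency_graph_def reachable_def mk_symmetric_def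
        intro: rtrancl_on_refl)
  ultimately show ?thesis by blast
qed

end

theory Submission
  imports Defs
begin

text \<open>Along a shortest walk, every facet after the first contributes two ridges that lie in no
  earlier facet. A walk with \<open>k\<close> steps therefore has \<open>2k + 3\<close> ridges among the
  \<open>n choose 2\<close> pairs, which gives the upper bound.

  For the lower bound, the complete graph on \<open>2m\<close> vertices contains \<open>m\<close> edge-disjoint zigzag
  paths with \<open>2m - 2\<close> edges, each ending where the next one starts. Coning the \<open>i\<close>-th path from
  a new apex \<open>a\<^sub>i\<close> gives a fan of triangles, and the triangle spanned by \<open>a\<^sub>i\<close>,
  \<open>a\<^sub>i\<^sub>+\<^sub>1\<close> and the common end point links two consecutive fans. With \<open>q\<close> apexes the strip
  has \<open>q(2m - 1) - 1\<close> triangles, and two of them share an edge only if they are consecutive.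
  Taking \<open>q\<close> and \<open>m\<close> close to \<open>n/3\<close> yields the bound.\<close>

section \<open>Counting the ridges of a corridor\<close>

text \<open>An induced path of \<open>k\<close> steps, hence \<open>k + 1\<close> facets, in the
  adjacency graph. The bound 1 in the last clause, instead of a mere inequality with 2, also forbids
  repeated facets.\<close>

definition corridor :: "nat \<Rightarrow> (nat \<Rightarrow> 'a set) \<Rightarrow> bool" where
  "corridor k X \<longleftrightarrow> (\<forall>i\<le>k. card (X i) = 3) \<and> (\<forall>i<k. card (X i \<inter> X (Suc i)) = 2)
    \<and> (\<forall>i j. i + 2 \<le> j \<and> j \<le> k \<longrightarrow> card (X i \<inter> X j) \<le> 1)"

lemma card_Diff_eq_1_iff:
  assumes "card A = 3"
  shows "card (A - B) = 1 \<longleftrightarrow> card (A \<inter> B) = 2"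
proof -
  have "finite A"
    using assms by (simp add: card_ge_0_finite)
  then have "card (A - B) + card (A \<inter> B) = 3"
    using card_Int_Diff[of A B] assms by simp
  then show ?thesis by linarith
qed

lemma corridor_length_le:
  assumes X: "corridor k X" and V: "finite V" "\<And>i. i \<le> k \<Longrightarrow> X i \<subseteq> V"
  shows "2 * k + 3 \<le> card V choose 2"
proof -
  define E where "E i = {e. e \<subseteq> X i \<and> card e = 2}" for i
  have finX: "finite (X i)" if "i \<le> k" for i
    using V that finite_subset by blast
  have finE: "finite (E i)" if "i \<le> k" for i
    using finX[OF that] by (auto simp: E_def)
  have cardE: "card (E i) = 3" if "i \<le> k" for i
    using n_subsets[of "X i" 2] finX that X by (auto simp: E_def corridor_def numeral_eq_Suc)
  have "card (\<Union>i\<le>l. E i) = 2 * l + 3" if "l \<le> k" for l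
    using that
  proof (induction l)
    case 0
    then show ?case using cardE by simp
  next
    case (Suc l)
    \<comment> \<open>The only old ridge of the new facet: a ridge has two vertices, so it can be
      shared with the preceding facet alone, where it fills the whole intersection.\<close>
    have "e = X l \<inter> X (Suc l)" if "i \<le> l" "e \<in> E i" "e \<in> E (Suc l)" for i e
    proof -
      have sub: "e \<subseteq> X i \<inter> X (Suc l)" and c: "card e = 2"
        using that by (auto simp: E_def)
      have fin: "finite (X i \<inter> X (Suc l))"
        using finX Suc.prems by blast
      have "i = l"
      proof (rule ccontr)
        assume "i \<noteq> l"
        then have "card (X i \<inter> X (Suc l)) \<le> 1"
          using X Suc.prems that by (auto simp: corridor_def)
        then show False
          using card_mono[OF fin sub] c by linarith
      qed
      then show ?thesis
        using card_subset_eq[OF fin sub] X Suc.prems c by (auto simp: corridor_def)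
    qed
    moreover have "X l \<inter> X (Suc l) \<in> E l" "X l \<inter> X (Suc l) \<in> E (Suc l)"
      using X Suc.prems by (auto simp: corridor_def E_def)
    ultimately have "(\<Union>i\<le>l. E i) \<inter> E (Suc l) = {X l \<inter> X (Suc l)}"
      by fastforce
    moreover have "card (\<Union>i\<le>l. E i) + card (E (Suc l)) =
        card ((\<Union>i\<le>l. E i) \<union> E (Suc l)) + card ((\<Union>i\<le>l. E i) \<inter> E (Suc l))"
      using Suc.prems finE by (intro card_Un_Int) auto
    moreover have "(\<Union>i\<le>Suc l. E i) = (\<Union>i\<le>l. E i) \<union> E (Suc l)"
      by (auto simp: atMost_Suc)
    ultimately show ?case
      using Suc cardE by simp
  qed
  moreover have "(\<Union>i\<le>k. E i) \<subseteq> {e. e \<subseteq> V \<and> card e = 2}"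
    using V(2) by (fastforce simp: E_def)
  then have "card (\<Union>i\<le>k. E i) \<le> card {e. e \<subseteq> V \<and> card e = 2}"
    using V(1) by (intro card_mono) auto
  ultimately show ?thesis
    using n_subsets[OF V(1), of 2] by simp
qed

section \<open>Shortest walks and the upper bound\<close>

lemma (in wf_digraph) awalk_cost_one: "awalk_cost (\<lambda>_. 1) p = real (length p)"
  by (induction p) auto

text \<open>Minimal length is argued with powers of the arc relation, whereas \<mu> is an infimum
  over arc walks; this passes from one to the other.\<close>

lemma (in pair_wf_digraph) relpow_awalk:
  assumes "(u, v) \<in> parcs G ^^ k" "u \<in> pverts G"
  shows "\<exists>p. awalk u p v \<and> length p = k"
  using assms
proof (induction k arbitrary: u)
  case 0
  then show ?case by (auto simp: awalk_Nil_iff)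
next
  case (Suc k)
  obtain w where w: "(u, w) \<in> parcs G" "(w, v) \<in> parcs G ^^ k"
    using relpow_Suc_D2[OF Suc.prems(1)] by blast
  then have "w \<in> pverts G"
    using in_arcsD2 by auto
  then obtain p where "awalk w p v" "length p = k"
    using Suc.IH w(2) by blast
  then show ?case
    using w(1) by (intro exI[of _ "(u, w) # p"]) (auto simp: awalk_Cons_iff)
qed

text \<open>A shortest walk is a corridor: a common ridge of two non-consecutive facets would give
  a shortcut.\<close>

lemma shortest_walk_corridor:
  assumes C: "pure_complex n 3 C" "strongly_connected_complex C" and uv: "u \<in> C" "v \<in> C"
  obtains k X where "corridor k X" "\<And>i. i \<le> k \<Longrightarrow> X i \<subseteq> {1..n}"
    "wf_digraph.\<mu> (with_proj (adjacency_graph C)) (\<lambda>_. 1) u v \<le> ereal (real k)"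
proof -
  interpret pair_wf_digraph "adjacency_graph C"
    by (rule pair_wf_digraph_adjacency_graph)
  define R where "R = parcs (adjacency_graph C)"
  have R_iff: "(A, B) \<in> R \<longleftrightarrow> A \<in> C \<and> B \<in> C \<and> card (A \<inter> B) = 2" for A B
    using C(1) card_Diff_eq_1_iff[of A B]
    by (auto simp: R_def adjacency_graph_def pure_complex_def)
  \<comment> \<open>Connectedness is phrased through the symmetric closure, which adds no arcs
    because \<open>R\<close> is already symmetric.\<close>
  have "parcs (mk_symmetric (with_proj (adjacency_graph C))) \<subseteq> R"
    unfolding parcs_mk_symmetric by (auto simp flip: R_def simp: R_iff Int_commute)
  moreover have "u \<rightarrow>\<^sup>*\<^bsub>with_proj (mk_symmetric (with_proj (adjacency_graph C)))\<^esub> v"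
    using C(2) uv unfolding strongly_connected_complex_def Digraph_Component.connected_def
      strongly_connected_def by (auto simp: adjacency_graph_def)
  then have "(u, v) \<in> (parcs (mk_symmetric (with_proj (adjacency_graph C))))\<^sup>*"
    using reachable_rtranclI by fastforce
  ultimately have "(u, v) \<in> R\<^sup>*"
    using rtrancl_mono by blast
  then have ex: "\<exists>k. (u, v) \<in> R ^^ k"
    by (simp add: rtrancl_power)
  define k where "k = (LEAST k. (u, v) \<in> R ^^ k)"
  have k: "(u, v) \<in> R ^^ k"
    unfolding k_def using ex by (rule LeastI_ex)
  have min: "k \<le> l" if "(u, v) \<in> R ^^ l" for l
    unfolding k_def using that by (rule Least_le)
  obtain X where X: "X 0 = u" "X k = v" "\<And>i. i < k \<Longrightarrow> (X i, X (Suc i)) \<in> R"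
    using k unfolding relpow_fun_conv by blast
  have XC: "X i \<in> C" if "i \<le> k" for i
    using that uv(2) X(2) X(3)[of i] R_iff by (cases "i = k") auto
  have card3: "card A = 3" "A \<subseteq> {1..n}" if "A \<in> C" for A
    using C(1) that by (auto simp: pure_complex_def)
  have "card (X i \<inter> X j) \<le> 1" if ij: "i + 2 \<le> j" "j \<le> k" for i j
  proof (rule ccontr)
    assume *: "\<not> card (X i \<inter> X j) \<le> 1"
    have C: "X i \<in> C" "X j \<in> C"
      using XC ij by auto
    have 1: "(u, X i) \<in> R ^^ i"
      unfolding relpow_fun_conv using X ij by (intro exI[of _ X]) auto
    have 2: "(X j, v) \<in> R ^^ (k - j)"
      unfolding relpow_fun_conv using X ij by (intro exI[of _ "\<lambda>t. X (j + t)"]) auto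
    have fin: "finite (X i)" "finite (X j)"
      using card3 C by (auto intro: finite_subset)
    have "card (X i \<inter> X j) = 2 \<or> card (X i \<inter> X j) = 3"
      using * card_mono[OF fin(1), of "X i \<inter> X j"] card3[OF C(1)] by auto
    \<comment> \<open>The shortcut takes one step if the facets share a ridge and none if they
      coincide; it replaces a segment of \<open>j - i \<ge> 2\<close> steps.\<close>
    then have "\<exists>e\<le>1. (X i, X j) \<in> R ^^ e"
    proof
      assume "card (X i \<inter> X j) = 2"
      then show ?thesis using C R_iff by (intro exI[of _ 1]) auto
    next
      assume a: "card (X i \<inter> X j) = 3"
      have "X i \<inter> X j = X i" "X i \<inter> X j = X j"
        using card_subset_eq[OF fin(1), of "X i \<inter> X j"] card_subset_eq[OF fin(2), of "X i \<inter> X j"]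
          a card3 C by auto
      then show ?thesis by (intro exI[of _ 0]) auto
    qed
    then obtain e where "e \<le> 1" "(X i, X j) \<in> R ^^ e" by blast
    then have "(u, v) \<in> R ^^ (i + e + (k - j))"
      using 1 2 by (auto simp: relpow_add)
    then show False
      using min \<open>e \<le> 1\<close> ij by fastforce
  qed
  then have "corridor k X"
    unfolding corridor_def using XC card3 X(3) R_iff by auto
  moreover obtain p where "awalk u p v" "length p = k"
    using relpow_awalk[of u v k] k uv(1) unfolding R_def by (auto simp: adjacency_graph_def)
  then have "\<mu> (\<lambda>_. 1) u v \<le> ereal (real k)"
    using min_cost_le_walk_cost[of u p v "\<lambda>_. 1"] by (simp add: awalk_cost_one)
  ultimately show thesis
    using that XC card3 by blast
qed

text \<open>The ridge count on \<open>n\<close> vertices reads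
  \<open>4 * k + 6 \<le> n * (n - 1)\<close>; the lower-order terms are then dropped.\<close>

lemma complex_diameter_le:
  assumes "pure_complex n 3 C" "strongly_connected_complex C"
  shows "complex_diameter C \<le> ereal (1 / 4 * (real n)\<^sup>2)"
  unfolding complex_diameter_def graph_diameter_def
proof (intro SUP_least)
  fix u v
  assume "u \<in> verts (with_proj (adjacency_graph C))" "v \<in> verts (with_proj (adjacency_graph C))"
  then have "u \<in> C" "v \<in> C"
    by (auto simp: adjacency_graph_def)
  then obtain k X where X: "corridor k X" "\<And>i. i \<le> k \<Longrightarrow> X i \<subseteq> {1..n}"
    and le: "wf_digraph.\<mu> (with_proj (adjacency_graph C)) (\<lambda>_. 1) u v \<le> ereal (real k)"
    using shortest_walk_corridor[OF assms] by metis
  have "2 * k + 3 \<le> n choose 2"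
    using corridor_length_le[OF X(1) _ X(2)] by simp
  then have "2 * (2 * k + 3) \<le> n * (n - 1)"
    by (simp add: choose_two)
  also have "\<dots> \<le> n\<^sup>2"
    by (simp add: power2_eq_square)
  finally have "2 * (2 * k + 3) \<le> n\<^sup>2" .
  then have "4 * k \<le> n\<^sup>2"
    by simp
  then have "real (4 * k) \<le> real (n\<^sup>2)"
    by (rule of_nat_mono)
  then have "real k \<le> 1 / 4 * (real n)\<^sup>2"
    by simp
  then show "wf_digraph.\<mu> (with_proj (adjacency_graph C)) (\<lambda>_. 1) u v \<le> ereal (1 / 4 * (real n)\<^sup>2)"
    using le by (meson ereal_less_eq(3) order_trans)
qed

section \<open>Corridors as complexes of large diameter\<close>

text \<open>Only forward moves are controlled: an arc advances the position by at most one, which is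
  what bounds walk lengths from below.\<close>

lemma corridor_adjacent:
  assumes X: "corridor k X" and ij: "i \<le> k" "j \<le> k" "2 \<le> card (X i \<inter> X j)"
  shows "j \<le> Suc i"
proof (rule ccontr)
  assume "\<not> j \<le> Suc i"
  then have "card (X i \<inter> X j) \<le> 1"
    using X ij by (auto simp: corridor_def)
  then show False
    using ij by simp
qed

lemma corridor_inj:
  assumes X: "corridor k X" and ij: "i \<le> k" "j \<le> k" "X i = X j"
  shows "i = j"
proof -
  have False if "i < j" "i \<le> k" "j \<le> k" "X i = X j" for i j
  proof -
    have "card (X i \<inter> X j) = 3"
      using X that by (auto simp: corridor_def)
    moreover have "card (X i \<inter> X j) \<le> 2"
    proof (cases "j = Suc i")
      case True
      then have "card (X i \<inter> X j) = 2"
        using X that unfolding corridor_def by (metis Suc_le_lessD)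
      then show ?thesis by simp
    next
      case False
      then have "i + 2 \<le> j" using that by simp
      then have "card (X i \<inter> X j) \<le> 1"
        using X that unfolding corridor_def by blast
      then show ?thesis by simp
    qed
    ultimately show False by simp
  qed
  then show ?thesis
    using ij by (metis linorder_neqE_nat)
qed

text \<open>The facets of the corridor are themselves the complex. Its two ends are at distance at
  least \<open>k\<close>, since each arc gains at most one position.\<close>

lemma corridor_le_H_s:
  assumes X: "corridor k X" and V: "\<And>i. i \<le> k \<Longrightarrow> X i \<subseteq> {1..n}"
  shows "ereal (real k) \<le> H_s n 3"
proof -
  define C where "C = X ` {..k}"
  interpret pair_wf_digraph "adjacency_graph C"
    by (rule pair_wf_digraph_adjacency_graph)
  have pure: "pure_complex n 3 C"
    using X V by (auto simp: pure_complex_def C_def corridor_def)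
  have arcs: "(A, B) \<in> parcs (adjacency_graph C) \<longleftrightarrow> A \<in> C \<and> B \<in> C \<and> card (A \<inter> B) = 2" for A B
    using pure card_Diff_eq_1_iff[of A B]
    by (auto simp: adjacency_graph_def pure_complex_def)
  let ?S = "mk_symmetric (with_proj (adjacency_graph C))"
  interpret S: pair_wf_digraph ?S
    by (rule wellformed_mk_symmetric)
  \<comment> \<open>Reachability from one end suffices, as paths in the symmetric closure can be
    reversed.\<close>
  have reach: "X 0 \<rightarrow>\<^sup>*\<^bsub>with_proj ?S\<^esub> X i" if "i \<le> k" for i
    using that
  proof (induction i)
    case 0
    then show ?case
      by (intro S.reachable_refl) (auto simp: adjacency_graph_def C_def)
  next
    case (Suc i)
    then have "(X i, X (Suc i)) \<in> parcs (adjacency_graph C)"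
      using X unfolding arcs by (auto simp: C_def corridor_def)
    then have "X i \<rightarrow>\<^bsub>with_proj ?S\<^esub> X (Suc i)"
      by (auto simp: parcs_mk_symmetric)
    then show ?case
      using Suc S.reachable_adj_trans by auto
  qed
  have "strongly_connected (with_proj ?S)"
    unfolding strongly_connected_def
  proof (intro conjI ballI)
    fix u v assume "u \<in> verts (with_proj ?S)" "v \<in> verts (with_proj ?S)"
    then obtain i j where "u = X i" "v = X j" "i \<le> k" "j \<le> k"
      by (auto simp: adjacency_graph_def C_def)
    then show "u \<rightarrow>\<^sup>*\<^bsub>with_proj ?S\<^esub> v"
      using reach S.reachable_trans symmetric_reachable[OF symmetric_mk_symmetric] by metis
  qed (auto simp: adjacency_graph_def C_def)
  then have conn: "strongly_connected_complex C"
    unfolding strongly_connected_complex_def Digraph_Component.connected_def .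
  have long: "j \<le> i + length p" if "awalk (X i) p (X j)" "i \<le> k" "j \<le> k" for i j p
    using that
  proof (induction p arbitrary: i)
    case Nil
    then show ?case
      using corridor_inj[OF X] by (auto simp: awalk_Nil_iff)
  next
    case (Cons e p)
    then have e: "e \<in> parcs (adjacency_graph C)" "fst e = X i" "awalk (snd e) p (X j)"
      by (auto simp: awalk_Cons_iff)
    then have *: "(X i, snd e) \<in> parcs (adjacency_graph C)"
      by (metis prod.collapse)
    then obtain l where l: "l \<le> k" "snd e = X l" "card (X i \<inter> X l) = 2"
      unfolding arcs by (auto simp: C_def)
    then have "l \<le> Suc i"
      using corridor_adjacent[OF X] Cons.prems by simp
    moreover have "j \<le> l + length p"
      using Cons.IH e l Cons.prems by simp
    ultimately show ?case by simp
  qed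
  have "ereal (real k) \<le> \<mu> (\<lambda>_. 1) (X 0) (X k)"
    unfolding \<mu>_def using long[of 0 _ k] by (intro INF_greatest) (auto simp: awalk_cost_one)
  also have "\<dots> \<le> complex_diameter C"
    unfolding complex_diameter_def graph_diameter_def
    by (intro SUP_upper2[where i = "X 0"] SUP_upper2[where i = "X k"])
      (auto simp: adjacency_graph_def C_def)
  also have "\<dots> \<le> H_s n 3"
    unfolding H_s_def using pure conn by (intro Max_ge finite_diameters) blast
  finally show ?thesis .
qed

section \<open>Strips of linked fans\<close>

lemma card_le_1I: "A \<subseteq> {x} \<Longrightarrow> card A \<le> 1"
  using card_mono[of "{x}" A] by simp

text \<open>Positions fall into blocks of length \<open>Suc r\<close>: first the \<open>r\<close>
  triangles of the fan with apex \<open>a i\<close>, then, at remainder \<open>r\<close>, the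
  triangle linking it to the next fan.\<close>

definition fan_strip :: "nat \<Rightarrow> (nat \<Rightarrow> 'a) \<Rightarrow> (nat \<Rightarrow> nat \<Rightarrow> 'a) \<Rightarrow> nat \<Rightarrow> 'a set" where
  "fan_strip r a w p = (let i = p div Suc r; j = p mod Suc r
    in {a i, w i j, if j < r then w i (Suc j) else a (Suc i)})"

text \<open>The bound excludes position \<open>q * Suc r - 1\<close>, the link triangle of the last
  block, which would use the apex \<open>a q\<close>.\<close>

lemma strip_position:
  assumes "p + 2 \<le> q * Suc r"
  obtains i j where "p = i * Suc r + j" "j \<le> r" "i < q" "j = r \<longrightarrow> Suc i < q"
proof -
  define i j where "i = p div Suc r" and "j = p mod Suc r"
  have p: "p = i * Suc r + j"
    unfolding i_def j_def by (rule div_mult_mod_eq[symmetric])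
  have "Suc i < q" if "j = r"
  proof -
    have "Suc i * Suc r < q * Suc r"
      using p that assms by simp
    then show ?thesis
      by (metis mult_less_cancel2)
  qed
  moreover have "i < q"
  proof -
    have "i * Suc r < q * Suc r"
      using p assms by linarith
    then show ?thesis
      by (metis mult_less_cancel2)
  qed
  moreover have "j \<le> r"
    by (simp add: j_def less_Suc_eq_le[symmetric])
  ultimately show thesis
    using that p by blast
qed

text \<open>Fans with different apexes can meet only in path vertices, and edge-disjoint paths keep
  such an intersection to one vertex. There are \<open>q * Suc r - 1\<close> triangles, hence one
  step fewer.\<close>

lemma corridor_fan_strip:
  assumes r: "0 < r" and a: "inj a" and aw: "\<And>i i' j. a i \<noteq> w i' j"
    and w: "\<And>i. i < q \<Longrightarrow> inj_on (w i) {..r}"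
    and link: "\<And>i. Suc i < q \<Longrightarrow> w i r = w (Suc i) 0"
    and edges: "\<And>i i' j j'. \<lbrakk>i < i'; i' < q; j < r; j' < r\<rbrakk>
      \<Longrightarrow> {w i j, w i (Suc j)} \<noteq> {w i' j', w i' (Suc j')}"
    and q: "0 < q"
  shows "corridor (q * Suc r - 2) (fan_strip r a w)"
proof -
  let ?T = "fan_strip r a w"
  define k where "k = q * Suc r - 2"
  have k: "p + 2 \<le> q * Suc r" if "p \<le> k" for p
    using r q that by (cases q) (auto simp: k_def)
  have a_eq: "a i = a j \<longleftrightarrow> i = j" for i j
    using a by (auto dest: injD)
  have aw': "w i' j \<noteq> a i" for i i' j
    using aw[of i i' j] by simp
  have w_eq: "w i j = w i j' \<longleftrightarrow> j = j'" if "i < q" "j \<le> r" "j' \<le> r" for i j j'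
    using inj_on_eq_iff[OF w[OF that(1)]] that by auto
  have T_fan: "?T (i * Suc r + j) = {a i, w i j, w i (Suc j)}" if "j < r" for i j
    using that by (simp add: fan_strip_def Let_def del: mult_Suc_right)
  have T_link: "?T (i * Suc r + r) = {a i, w i r, a (Suc i)}" for i
    by (simp add: fan_strip_def Let_def del: mult_Suc_right)
  have pos: "\<exists>i j. p = i * Suc r + j \<and> j \<le> r \<and> i < q \<and> (j = r \<longrightarrow> Suc i < q)" if "p \<le> k" for p
    using strip_position[of p q r] k[OF that] by metis
  show ?thesis
    unfolding corridor_def k_def[symmetric]
  proof (intro conjI allI impI)
    fix p assume "p \<le> k"
    then obtain i j where p: "p = i * Suc r + j" "j \<le> r" "i < q"
      using pos by blast
    show "card (?T p) = 3"
    proof (cases "j = r")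
      case True
      show ?thesis unfolding p(1) True T_link by (simp add: aw aw' a_eq)
    next
      case False
      then have "j < r" using p by simp
      then show ?thesis unfolding p(1) T_fan[OF \<open>j < r\<close>] using p by (simp add: aw w_eq)
    qed
  next
    fix p assume "p < k"
    then obtain i j where p: "p = i * Suc r + j" "j \<le> r" "i < q" "j = r \<longrightarrow> Suc i < q"
      using pos[of p] by auto
    consider "Suc j < r" | "Suc j = r" | "j = r"
      using p(2) by linarith
    then show "card (?T p \<inter> ?T (Suc p)) = 2"
    proof cases
      case 1
      have "?T p \<inter> ?T (Suc p) = {a i, w i (Suc j)}"
        using 1 p T_fan[of j i] T_fan[of "Suc j" i] by (auto simp: aw aw' w_eq)
      then show ?thesis by (simp add: aw)
    next
      case 2
      have "?T p \<inter> ?T (Suc p) = {a i, w i (Suc j)}"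
        using 2 p T_fan[of j i] T_link[of i] by (auto simp: aw aw' w_eq)
      then show ?thesis by (simp add: aw)
    next
      case 3
      \<comment> \<open>After a link triangle the position wraps to remainder 0 of the next block,
        whose path starts at \<open>w i r\<close>.\<close>
      have "Suc p = Suc i * Suc r + 0"
        using 3 p by simp
      then have "?T (Suc p) = {a (Suc i), w i r, w (Suc i) (Suc 0)}"
        using T_fan[of 0 "Suc i"] r link p 3 by (simp add: ac_simps)
      then have "?T p \<inter> ?T (Suc p) = {a (Suc i), w i r}"
        using 3 p T_link[of i] by (auto simp: aw aw' a_eq)
      then show ?thesis by (simp add: aw)
    qed
  next
    fix p p' assume pp: "p + 2 \<le> p' \<and> p' \<le> k"
    then obtain i j where p: "p = i * Suc r + j" "j \<le> r" "i < q" "j = r \<longrightarrow> Suc i < q"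
      using pos[of p] by auto
    obtain i' j' where p': "p' = i' * Suc r + j'" "j' \<le> r" "i' < q" "j' = r \<longrightarrow> Suc i' < q"
      using pp pos[of p'] by auto
    have "i \<le> i'"
    proof (rule ccontr)
      assume "\<not> i \<le> i'"
      then have "Suc i' * Suc r \<le> i * Suc r"
        by (intro mult_right_mono) auto
      then show False using p p' pp by simp
    qed
    \<comment> \<open>In order: same block; two fans; a fan and a later link; a link and a block
      beyond the next; a link and the next block past its first triangle, which would be
      consecutive.\<close>
    then consider "i = i'" "j + 2 \<le> j'" | "i < i'" "j < r" "j' < r" | "i < i'" "j < r" "j' = r"
      | "Suc i < i'" "j = r" | "Suc i = i'" "j = r" "0 < j'"
      using p p' pp by (cases "i = i'"; cases "Suc i = i'"; cases "j = r"; cases "j' = r"; force)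
    then show "card (?T p \<inter> ?T p') \<le> 1"
    proof cases
      case 1
      have "?T p \<inter> ?T p' \<subseteq> {a i}"
        using 1 p p' T_fan[of j i] T_fan[of j' i] T_link[of i]
        by (cases "j' = r") (auto simp: aw aw' w_eq)
      then show ?thesis by (rule card_le_1I)
    next
      case 2
      let ?e = "{w i j, w i (Suc j)}" and ?e' = "{w i' j', w i' (Suc j')}"
      have "card ?e = 2" "card ?e' = 2"
        using 2 p p' by (auto simp: w_eq)
      \<comment> \<open>Two edges with two common vertices would be equal, contrary to
        edge-disjointness.\<close>
      then have "\<not> 2 \<le> card (?e \<inter> ?e')"
        using card_seteq[of ?e "?e \<inter> ?e'"] card_seteq[of ?e' "?e \<inter> ?e'"] edges[OF 2(1) p'(3) 2(2,3)]
        by auto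
      moreover have "?T p \<inter> ?T p' = ?e \<inter> ?e'"
        unfolding p(1) p'(1) T_fan[OF 2(2)] T_fan[OF 2(3)] using 2 by (auto simp: aw aw' a_eq)
      ultimately show ?thesis by simp
    next
      case 3
      have "?T p \<inter> ?T p' \<subseteq> {w i' r}"
        unfolding p(1) p'(1) 3(3) T_fan[OF 3(2)] T_link using 3 by (auto simp: aw aw' a_eq)
      then show ?thesis by (rule card_le_1I)
    next
      case 4
      have "?T p \<inter> ?T p' \<subseteq> {w i r}"
        using 4 p p' T_fan[of j' i'] T_link[of i] T_link[of i']
        by (cases "j' = r") (auto simp: aw aw' a_eq)
      then show ?thesis by (rule card_le_1I)
    next
      case 5
      have "w i r = w i' 0"
        using link 5 p' by auto
      then have "?T p \<inter> ?T p' \<subseteq> {a i'}"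
        using 5 p p' T_fan[of j' i'] T_link[of i] T_link[of i']
        by (cases "j' = r") (auto simp: aw aw' a_eq w_eq)
      then show ?thesis by (rule card_le_1I)
    qed
  qed
qed

section \<open>Edge-disjoint zigzag paths\<close>

text \<open>The offsets 0, 1, -1, 2, -2, ... of Walecki's decomposition of a complete graph into
  paths.\<close>

definition zigzag :: "nat \<Rightarrow> int" where
  "zigzag j = (if even j then - int (j div 2) else int (Suc j div 2))"

text \<open>Offsets of consecutive vertices add up to \<open>1\<close> and \<open>0\<close> alternately. The shift by \<open>m + 1\<close>
  moves the start of the next path onto the end of the current one.\<close>

definition zigzag_vertex :: "nat \<Rightarrow> nat \<Rightarrow> nat \<Rightarrow> nat" where
  "zigzag_vertex m i j = nat ((int i * (int m + 1) + zigzag j) mod (2 * int m)) + 1"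

lemma zigzag_inj: "zigzag j = zigzag j' \<Longrightarrow> j = j'"
  unfolding zigzag_def by (auto split: if_splits elim!: evenE oddE)

text \<open>Stopping before \<open>j = 2 * m - 1\<close>, whose offset is \<open>m\<close>, keeps
  offsets so close that distinct ones stay distinct modulo \<open>2 * m\<close>.\<close>

lemma zigzag_bounds: "j \<le> 2 * m - 2 \<Longrightarrow> 0 < m \<Longrightarrow> \<bar>zigzag j\<bar> < int m"
  unfolding zigzag_def by (auto elim!: evenE oddE)

lemma zigzag_sum: "zigzag j + zigzag (Suc j) \<in> {0, 1}"
  unfolding zigzag_def by (auto elim!: evenE oddE)

lemma zigzag_vertex_mod:
  "0 < m \<Longrightarrow> int (zigzag_vertex m i j) - 1 = (int i * (int m + 1) + zigzag j) mod (2 * int m)"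
  by (simp add: zigzag_vertex_def)

lemma zigzag_vertex_bounds: "0 < m \<Longrightarrow> zigzag_vertex m i j \<in> {1..2 * m}"
proof -
  assume "0 < m"
  then have "(int i * (int m + 1) + zigzag j) mod (2 * int m) < 2 * int m"
    by simp
  then show ?thesis
    by (simp add: zigzag_vertex_def nat_less_iff Suc_le_eq)
      (use \<open>0 < m\<close> in linarith)
qed

lemma zigzag_vertex_inj:
  assumes "0 < m"
  shows "inj_on (zigzag_vertex m i) {..2 * m - 2}"
proof (rule inj_onI)
  fix j j' assume j: "j \<in> {..2 * m - 2}" "j' \<in> {..2 * m - 2}"
    and "zigzag_vertex m i j = zigzag_vertex m i j'"
  then have "(int i * (int m + 1) + zigzag j) mod (2 * int m)
      = (int i * (int m + 1) + zigzag j') mod (2 * int m)"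
    using assms by (metis zigzag_vertex_mod)
  then have "2 * int m dvd zigzag j - zigzag j'"
    by (simp add: mod_eq_dvd_iff)
  moreover have "\<bar>zigzag j - zigzag j'\<bar> < 2 * int m"
    using zigzag_bounds[of j m] zigzag_bounds[of j' m] j assms by auto
  ultimately have "zigzag j - zigzag j' = 0"
    using dvd_imp_le_int[of "zigzag j - zigzag j'" "2 * int m"] by linarith
  then show "j = j'"
    using zigzag_inj by simp
qed

lemma zigzag_vertex_link:
  assumes "0 < m"
  shows "zigzag_vertex m i (2 * m - 2) = zigzag_vertex m (Suc i) 0"
proof -
  have "2 * m - 2 = 2 * (m - 1)" by simp
  then have "zigzag (2 * m - 2) = 1 - int m"
    using assms by (simp add: zigzag_def)
  \<comment> \<open>The shift \<open>m + 1\<close> exceeds the final offset \<open>1 - m\<close> by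
    one full turn.\<close>
  then have "int (Suc i) * (int m + 1) + zigzag 0
      = int i * (int m + 1) + zigzag (2 * m - 2) + 2 * int m"
    by (simp add: zigzag_def algebra_simps)
  then show ?thesis
    by (simp add: zigzag_vertex_def del: of_nat_Suc)
qed

text \<open>The sum of the end points of an edge determines the path, since it is \<open>2i\<close> or \<open>2i + 1\<close>
  modulo \<open>2m\<close> on the \<open>i\<close>-th path.\<close>

lemma zigzag_vertex_edges:
  assumes "i < i'" "i' < m"
  shows "{zigzag_vertex m i j, zigzag_vertex m i (Suc j)}
    \<noteq> {zigzag_vertex m i' j', zigzag_vertex m i' (Suc j')}"
proof
  assume *: "{zigzag_vertex m i j, zigzag_vertex m i (Suc j)}
    = {zigzag_vertex m i' j', zigzag_vertex m i' (Suc j')}"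
  define e where "e i j = 2 * int i + (zigzag j + zigzag (Suc j))" for i j
  \<comment> \<open>Twice the shift \<open>i * (m + 1)\<close> is \<open>2 * i\<close> plus a
    multiple of \<open>2 * m\<close>; for \<open>i < m\<close> the value \<open>e i j\<close>, at
    most \<open>2 * i + 1\<close>, is already reduced.\<close>
  have sum: "(int (zigzag_vertex m i j) - 1 + (int (zigzag_vertex m i (Suc j)) - 1)) mod (2 * int m)
      = e i j" if "i < m" for i j
  proof -
    have "(int (zigzag_vertex m i j) - 1 + (int (zigzag_vertex m i (Suc j)) - 1)) mod (2 * int m)
      = (e i j + int i * (2 * int m)) mod (2 * int m)"
      using that by (simp add: zigzag_vertex_mod mod_add_eq e_def algebra_simps)
    also have "\<dots> = e i j mod (2 * int m)" by (rule mod_mult_self1)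
    also have "\<dots> = e i j"
      using that zigzag_sum[of j] by (intro mod_pos_pos_trivial) (auto simp: e_def)
    finally show ?thesis .
  qed
  have "e i j = e i' j'"
    using sum[of i j] sum[of i' j'] * assms by (auto simp: doubleton_eq_iff add.commute)
  then show False
    using zigzag_sum[of j] zigzag_sum[of j'] assms by (auto simp: e_def)
qed

section \<open>The lower bound\<close>

text \<open>Paths live on the vertices up to \<open>2 * m\<close>, and the \<open>q\<close> apexes
  are the next ones. The \<open>m\<close> disjoint zigzags allow \<open>q\<close> up to
  \<open>m\<close>.\<close>

lemma fans_le_H_s:
  assumes m: "2 \<le> m" and q: "0 < q" "q \<le> m" and n: "2 * m + q \<le> n"
  shows "ereal (real (q * (2 * m - 1) - 2)) \<le> H_s n 3"
proof -
  let ?r = "2 * m - 2" and ?a = "\<lambda>i. 2 * m + 1 + i"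
  let ?X = "fan_strip ?r ?a (zigzag_vertex m)"
  have m0: "0 < m" and r: "Suc ?r = 2 * m - 1"
    using m by auto
  have w: "1 \<le> zigzag_vertex m i j" "zigzag_vertex m i j \<le> 2 * m" for i j
    using zigzag_vertex_bounds[OF m0, of i j] by auto
  have "corridor (q * Suc ?r - 2) ?X"
  proof (rule corridor_fan_strip)
    show "?a i \<noteq> zigzag_vertex m i' j" for i i' j
      using w(2)[of i' j] by linarith
    show "{zigzag_vertex m i j, zigzag_vertex m i (Suc j)}
        \<noteq> {zigzag_vertex m i' j', zigzag_vertex m i' (Suc j')}"
      if "i < i'" "i' < q" for i i' j j'
      using zigzag_vertex_edges that q by simp
  qed (use m q zigzag_vertex_inj[OF m0] zigzag_vertex_link[OF m0] in \<open>auto simp: inj_def\<close>)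
  moreover have "?X p \<subseteq> {1..n}" if "p \<le> q * Suc ?r - 2" for p
  proof -
    have "2 \<le> 1 * Suc ?r"
      using m by simp
    also have "\<dots> \<le> q * Suc ?r"
      using q by (intro mult_right_mono) auto
    finally have "p + 2 \<le> q * Suc ?r"
      using that by linarith
    then obtain i j where p: "p = i * Suc ?r + j" "j \<le> ?r" "i < q" "j = ?r \<longrightarrow> Suc i < q"
      by (rule strip_position)
    have "p div Suc ?r = i" "p mod Suc ?r = j"
      unfolding p(1) using p(2) by (auto simp: div_mult_self3 simp del: mult_Suc_right)
    moreover have "zigzag_vertex m i j \<le> n" for i j
      using w(2)[of i j] n by linarith
    ultimately show ?thesis
      using p n w(1) by (auto simp: fan_strip_def)
  qed
  ultimately have "ereal (real (q * Suc ?r - 2)) \<le> H_s n 3"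
    by (rule corridor_le_H_s)
  then show ?thesis
    unfolding r .
qed

text \<open>Two triangles on a common edge settle \<open>n = 4\<close> and \<open>n = 5\<close>,
  where the claimed bound is at most 8/9.\<close>

lemma one_le_H_s:
  assumes "4 \<le> n"
  shows "1 \<le> H_s n 3"
proof -
  define X where "X i = (if i = 0 then {1, 2, 3} else {1, 2, 4::nat})" for i :: nat
  have "X 0 \<inter> X 1 = {1, 2}"
    by (auto simp: X_def)
  then have "corridor 1 X"
    by (auto simp: corridor_def X_def)
  moreover have "X i \<subseteq> {1..n}" for i
    using assms by (auto simp: X_def)
  ultimately have "ereal (real 1) \<le> H_s n 3"
    by (rule corridor_le_H_s)
  then show ?thesis by (simp add: one_ereal_def)
qed

lemma H_s_nonneg:
  assumes "3 \<le> n"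
  shows "0 \<le> H_s n 3"
proof -
  have "corridor 0 (\<lambda>_. {1, 2, 3::nat})"
    by (simp add: corridor_def)
  then have "ereal (real 0) \<le> H_s n 3"
    by (rule corridor_le_H_s) (use assms in auto)
  then show ?thesis by (simp add: zero_ereal_def)
qed

lemma H_s_lower:
  assumes "3 \<le> n"
  shows "ereal (2 / 9 * (real n - 3)\<^sup>2) \<le> H_s n 3"
proof -
  consider "n = 3" | "n = 4 \<or> n = 5" | "6 \<le> n"
    using assms by linarith
  then show ?thesis
  proof cases
    case 1
    then show ?thesis using H_s_nonneg by (simp add: zero_ereal_def)
  next
    case 2
    then have "2 / 9 * (real n - 3)\<^sup>2 \<le> 1"
      by auto
    then have "ereal (2 / 9 * (real n - 3)\<^sup>2) \<le> 1"
      by (simp add: one_ereal_def)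
    also have "\<dots> \<le> H_s n 3"
      using one_le_H_s 2 by auto
    finally show ?thesis .
  next
    case 3
    define k where "k = n div 3"
    have k: "2 \<le> k"
      using 3 by (simp add: k_def)
    consider "n = 3 * k \<or> n = 3 * k + 1" | "n = 3 * k + 2"
      by (simp add: k_def) linarith
    then show ?thesis
    proof cases
      case 1
      \<comment> \<open>Here \<open>q = m = k\<close>, using \<open>3 * k\<close> vertices. This
        inequality shows that the subtraction of 2 is not truncated.\<close>
      have "2 * 1 \<le> k * (2 * k - 1)"
        using k by (intro mult_mono) auto
      then have "real (k * (2 * k - 1) - 2) = real k * (2 * real k - 1) - 2"
        using k by (simp add: of_nat_diff)
      moreover have "2 / 9 * (real n - 3)\<^sup>2 \<le> real k * (2 * real k - 1) - 2"
        using 1 k by (auto simp: power2_eq_square field_simps)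
      moreover have "ereal (real (k * (2 * k - 1) - 2)) \<le> H_s n 3"
        using 1 k by (intro fans_le_H_s) auto
      ultimately show ?thesis
        by (metis ereal_less_eq(3) order_trans)
    next
      case 2
      \<comment> \<open>The two extra vertices go to the paths: \<open>m = k + 1\<close> and
        \<open>q = k\<close>.\<close>
      have "2 * 1 \<le> k * (2 * (k + 1) - 1)"
        using k by (intro mult_mono) auto
      then have "real (k * (2 * (k + 1) - 1) - 2) = real k * (2 * real k + 1) - 2"
        using k by (simp add: of_nat_diff algebra_simps)
      moreover have "2 / 9 * (real n - 3)\<^sup>2 \<le> real k * (2 * real k + 1) - 2"
        using 2 k by (auto simp: power2_eq_square field_simps)
      moreover have "ereal (real (k * (2 * (k + 1) - 1) - 2)) \<le> H_s n 3"
        using 2 k by (intro fans_le_H_s) auto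
      ultimately show ?thesis
        by (metis ereal_less_eq(3) order_trans)
    qed
  qed
qed

theorem theorem2p8:
  fixes n :: nat
  assumes "n \<ge> 3"
  shows "ereal (2 / 9 * (real n - 3)\<^sup>2) \<le> H_s n 3 \<and> H_s n 3 \<le> ereal (1 / 4 * (real n)\<^sup>2)"
proof
  show "H_s n 3 \<le> ereal (1 / 4 * (real n)\<^sup>2)"
    unfolding H_s_def
    using finite_diameters diameters_nonempty[OF assms] complex_diameter_le
    by (intro Max.boundedI) auto
qed (rule H_s_lower[OF assms])

end
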